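(* Let $f\in\mathcal{S}^{*}_{\mathrm{lune}}$. Then $$|H_{2,1}(F_f/2)|\le \frac{1}{16}.$$ The inequality is sharp: equality holds for the function $g\in\mathcal{S}^{*}_{\mathrm{lune}}$ given by $$g(z)=z\exp\left(\int_0^z\frac{x^2+\sqrt{1+x^4}-1}{x}\,dx\right)=z+\frac{z^3}{2}+\frac{z^5}{4}+\cdots,\qquad z\in\mathbb{D}.$$
   Context: $\mathbb{D}=\{z\in\mathbb{C}:|z|<1\}$. $\mathcal{S}$ is the class of univalent (injective holomorphic) functions on $\mathbb{D}$ of the form $f(z)=z+\sum_{n\ge2}a_nz^n$. For analytic functions $F,G$ on $\mathbb{D}$, $F\prec G$ ($F$ is subordinate to $G$) means that there is an analytic $w:\mathbb{D}\to\mathbb{D}$ with $w(0)=0$ and $F(z)=G(w(z))$ for all $z\in\mathbb{D}$. Let $q(z)=z+\sqrt{1+z^2}$ for $z\in\mathbb{D}$, with the branch of the square root chosen so that $q(0)=1$. The class of starlike functions associated with the lune is $$\mathcal{S}^{*}_{\mathrm{lune}}=\left\{f\in\mathcal{S}:\ \frac{zf'(z)}{f(z)}\prec q(z)\right\}.$$ The square root in the definition of $g$ is likewise the branch equal to $1$ at $x=0$. For $f\in\mathcal{S}$, the logarithmic coefficients $\gamma_n=\gamma_n(f)$ are defined by $$F_f(z)=\log\frac{f(z)}{z}=2\sum_{n=1}^\infty\gamma_n z^n,\qquad \log 1=0,$$ and $$H_{2,1}(F_f/2)=\gamma_1\gamma_3-\gamma_2^2=\frac{1}{48}\left(a_2^4-12a_3^2+12a_2a_4\right).$$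 *)

theory Defs
  imports "HOL-Complex_Analysis.Complex_Analysis"
begin

text \<open>
  Analytic functions on the unit disc are represented by total functions of type
  \<^typ>\<open>complex \<Rightarrow> complex\<close>; their values outside \<open>ball 0 1\<close> play no role.
\<close>

definition class_S :: "(complex \<Rightarrow> complex) set" where
  "class_S = {f. f holomorphic_on ball 0 1 \<and> inj_on f (ball 0 1) \<and> f 0 = 0 \<and> deriv f 0 = 1}"

definition subordinate :: "(complex \<Rightarrow> complex) \<Rightarrow> (complex \<Rightarrow> complex) \<Rightarrow> bool"
    (infix "\<prec>\<^sub>s" 50) where
  "F \<prec>\<^sub>s G \<longleftrightarrow>
     F holomorphic_on ball 0 1 \<and> G holomorphic_on ball 0 1 \<and>
     (\<exists>w. w holomorphic_on ball 0 1 \<and> w ` ball 0 1 \<subseteq> ball 0 1 \<and> w 0 = 0 \<and>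
          (\<forall>z\<in>ball 0 1. F z = G (w z)))"

text \<open>
  For \<open>z\<close> in the unit disc, \<open>1 + z\<^sup>2\<close> and \<open>1 + z ^ 4\<close> have positive real part, so the
  principal root \<^const>\<open>csqrt\<close> is analytic there and is the branch with value 1 at 0.
\<close>

definition lune_fun :: "complex \<Rightarrow> complex" where
  "lune_fun z = z + csqrt (1 + z\<^sup>2)"

text \<open>
  The quotient \<open>z f'(z) / f(z)\<close> has a removable singularity at 0, with value 1 for normalised
  \<open>f\<close>. Division by zero would give 0 there, so the value is filled in by hand.
\<close>

definition starlike_quotient :: "(complex \<Rightarrow> complex) \<Rightarrow> complex \<Rightarrow> complex" where
  "starlike_quotient f z = (if z = 0 then 1 else z * deriv f z / f z)"

definition S_lune :: "(complex \<Rightarrow> complex) set" where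
  "S_lune = {f \<in> class_S. starlike_quotient f \<prec>\<^sub>s lune_fun}"

text \<open>
  The analytic branch on the whole disc of \<open>log (f z / z)\<close> that vanishes at 0. For \<open>f\<close> in
  \<^const>\<open>class_S\<close> it exists and is determined on the disc, as the lemmas below show; the
  principal logarithm would not do, since \<open>f z / z\<close> may cross the negative real axis.
\<close>

definition is_log_quotient :: "(complex \<Rightarrow> complex) \<Rightarrow> (complex \<Rightarrow> complex) \<Rightarrow> bool" where
  "is_log_quotient f F \<longleftrightarrow> F holomorphic_on ball 0 1 \<and> F 0 = 0 \<and>
     (\<forall>z\<in>ball 0 1 - {0}. exp (F z) = f z / z)"

definition log_quotient :: "(complex \<Rightarrow> complex) \<Rightarrow> complex \<Rightarrow> complex" where
  "log_quotient f = (SOME F. is_log_quotient f F)"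

definition log_coeff :: "(complex \<Rightarrow> complex) \<Rightarrow> nat \<Rightarrow> complex" where
  "log_coeff f n = fps_nth (fps_expansion (log_quotient f) 0) n / 2"

definition hankel21_log :: "(complex \<Rightarrow> complex) \<Rightarrow> complex" where
  "hankel21_log f = log_coeff f 1 * log_coeff f 3 - (log_coeff f 2)\<^sup>2"

text \<open>
  The integral is taken along the segment from 0 to \<open>z\<close>. The integrand has a removable
  singularity at 0 with value 0, which is what division by zero gives.
\<close>

definition extremal_g :: "complex \<Rightarrow> complex" where
  "extremal_g z =
     z * exp (contour_integral (linepath 0 z) (\<lambda>x. (x\<^sup>2 + csqrt (1 + x ^ 4) - 1) / x))"

lemma is_log_quotient_exists:
  assumes "f \<in> class_S"
  shows "\<exists>F. is_log_quotient f F"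
proof -
  have hol: "f holomorphic_on ball 0 1" and inj: "inj_on f (ball 0 1)"
    and f0: "f 0 = 0" and d: "deriv f 0 = 1"
    using assms by (auto simp: class_S_def)
  define h where "h z = (if z = 0 then 1 else f z / z)" for z
  have "h holomorphic_on ball 0 1"
    by (rule pole_theorem_open_0[OF hol, where a = 0]) (auto simp: h_def f0 d)
  moreover have "h z \<noteq> 0" if "z \<in> ball 0 1" for z
    using inj_onD[OF inj, of z 0] that f0 by (auto simp: h_def)
  ultimately obtain G where G: "G holomorphic_on ball 0 1"
      "\<And>z. z \<in> ball 0 1 \<Longrightarrow> exp (G z) = h z"
    using holomorphic_logarithm_exists[of "ball 0 1" h 0] by auto
  have "exp (G 0) = 1"
    using G(2)[of 0] by (simp add: h_def)
  then have "is_log_quotient f (\<lambda>z. G z - G 0)"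
    using G by (auto simp: is_log_quotient_def exp_diff h_def intro!: holomorphic_intros)
  then show ?thesis by blast
qed

lemma is_log_quotient_log_quotient:
  "f \<in> class_S \<Longrightarrow> is_log_quotient f (log_quotient f)"
  unfolding log_quotient_def by (rule someI_ex[OF is_log_quotient_exists])

lemma is_log_quotient_unique:
  assumes "is_log_quotient f F" "is_log_quotient f G" "z \<in> ball 0 1"
  shows "F z = G z"
proof -
  let ?D = "\<lambda>z. F z - G z"
  have hol: "?D holomorphic_on ball 0 1"
    using assms by (auto simp: is_log_quotient_def intro!: holomorphic_intros)
  have e: "exp (?D x) = 1" if "x \<in> ball 0 1" for x
  proof (cases "x = 0")
    case False
    then have "exp (F x) = exp (G x)"
      using assms that by (simp add: is_log_quotient_def)
    then show ?thesis by (simp add: exp_diff)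
  qed (use assms in \<open>simp add: is_log_quotient_def\<close>)
  have "(?D has_field_derivative 0) (at x)" if x: "x \<in> ball 0 1" for x
  proof -
    have D: "(?D has_field_derivative deriv ?D x) (at x)"
      using hol x by (rule holomorphic_derivI[OF _ open_ball])
    have "((\<lambda>y. exp (?D y)) has_field_derivative exp (?D x) * deriv ?D x) (at x)"
      by (rule DERIV_fun_exp[OF D])
    moreover have "((\<lambda>y. exp (?D y)) has_field_derivative 0) (at x)"
      by (rule has_field_derivative_transform_within_open[OF DERIV_const open_ball x])
         (use e in auto)
    ultimately have "exp (?D x) * deriv ?D x = 0"
      by (rule DERIV_unique)
    then show ?thesis using D by simp
  qed
  then have "?D constant_on ball 0 1"
    by (intro has_field_derivative_0_imp_constant_on) auto
  then show ?thesis
    using assms unfolding constant_on_def is_log_quotient_def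
    by (metis centre_in_ball diff_self eq_iff_diff_eq_0 zero_less_one)
qed

end

theory Submission
  imports Defs
begin

text \<open>
  Write \<open>z f' / f = q(w)\<close> with a Schwarz function \<open>w = c\<^sub>1 z + c\<^sub>2 z\<^sup>2 + c\<^sub>3 z\<^sup>3 + \<dots>\<close>. Since
  \<open>z F\<^sub>f' = q(w) - 1\<close>, comparing coefficients gives
  \<open>48 H = 4 c\<^sub>1 c\<^sub>3 + c\<^sub>1\<^sup>2 c\<^sub>2 - 3 c\<^sub>2\<^sup>2 - (3/4) c\<^sub>1\<^sup>4\<close>. Three steps of the Schur algorithm
  parametrise \<open>c\<^sub>1\<close>, \<open>c\<^sub>2\<close>, \<open>c\<^sub>3\<close> by points of the closed disc. The triangle inequality then
  leaves an expression increasing in \<open>\<bar>x\<bar>\<close>, where \<open>x\<close> is the second parameter; at \<open>\<bar>x\<bar> = 1\<close> it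
  equals \<open>3 - C\<^sup>2 - (5/4) C\<^sup>4\<close> with \<open>C = \<bar>c\<^sub>1\<bar>\<close>. The function \<open>g\<close> belongs to \<open>w = z\<^sup>2\<close>, and it is
  univalent because \<open>q\<close> has positive real part, that is, because \<open>g\<close> is starlike.
\<close>

section \<open>Schwarz functions: Schur parameters and a coefficient estimate\<close>

text \<open>Turns a functional identity on the disc into an identity of formal power series, whose
  coefficients can then be compared. It works because the expansion depends only on the germ at
  0.\<close>

lemma has_fps_expansion_unique_on_ball:
  fixes f g :: "complex \<Rightarrow> complex"
  assumes "f has_fps_expansion F" "g has_fps_expansion G" "\<And>z. z \<in> ball 0 1 \<Longrightarrow> f z = g z"
  shows "F = G"
proof -
  have "eventually (\<lambda>z. z \<in> ball 0 1) (nhds (0::complex))"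
    by (intro eventually_nhds_in_open) auto
  then have "eventually (\<lambda>z. f z = g z) (nhds 0)"
    by eventually_elim (use assms(3) in auto)
  then have "f has_fps_expansion G"
    using assms(2) has_fps_expansion_cong[of f g G G] by simp
  with assms(1) show ?thesis
    by (rule fps_expansion_unique_complex)
qed

lemma has_fps_expansion_ball:
  "f holomorphic_on ball 0 1 \<Longrightarrow> f has_fps_expansion fps_expansion f 0"
  by (rule has_fps_expansion_fps_expansion[of "ball 0 1"]) auto

text \<open>For nonconstant \<open>\<phi>\<close> the maximum principle gives |phi| < 1, the disc
  automorphism sending \<open>\<phi> 0\<close> to 0 can be composed with \<open>\<phi>\<close>, and
  the Schwarz lemma splits off a factor z. Clearing the denominator gives an identity that also
  covers constants, even unimodular ones, with \<open>\<psi>\<close> = 0.\<close>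

lemma schur_step:
  assumes hol: "\<phi> holomorphic_on ball 0 1"
    and le: "\<And>z. z \<in> ball 0 1 \<Longrightarrow> cmod (\<phi> z) \<le> 1"
  obtains \<psi> where "\<psi> holomorphic_on ball 0 1" "\<And>z. z \<in> ball 0 1 \<Longrightarrow> cmod (\<psi> z) \<le> 1"
    "\<And>z. z \<in> ball 0 1 \<Longrightarrow> \<phi> z - \<phi> 0 = z * \<psi> z * (1 - cnj (\<phi> 0) * \<phi> z)"
proof (cases "\<phi> constant_on ball 0 1")
  case True
  then have c: "\<phi> z = \<phi> 0" if "z \<in> ball 0 1" for z
    using that unfolding constant_on_def by (metis centre_in_ball zero_less_one)
  show thesis
    by (rule that[of "\<lambda>_. 0"]) (simp_all only: c holomorphic_on_const, simp_all)
next
  case False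
  have lt: "cmod (\<phi> z) < 1" if z: "z \<in> ball 0 1" for z
  proof (rule ccontr)
    assume "\<not> cmod (\<phi> z) < 1"
    then have "cmod (\<phi> y) \<le> cmod (\<phi> z)" if "y \<in> ball 0 1" for y
      using le[OF that] by simp
    then have "\<phi> constant_on ball 0 1"
      by (intro maximum_modulus_principle[OF hol open_ball connected_ball open_ball order_refl z])
    with False show False by simp
  qed
  define a where "a = \<phi> 0"
  have a: "cmod a < 1"
    using lt[of 0] by (simp add: a_def)
  have nz: "1 - cnj a * \<phi> z \<noteq> 0" if "z \<in> ball 0 1" for z
  proof
    assume "1 - cnj a * \<phi> z = 0"
    then have "cmod (cnj a * \<phi> z) = 1" by (metis eq_iff_diff_eq_0 norm_one)
    moreover have "cmod (cnj a * \<phi> z) < 1"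
      using a lt[OF that] mult_strict_mono'[of "cmod a" 1 "cmod (\<phi> z)" 1] by (simp add: norm_mult)
    ultimately show False by simp
  qed
  define m where "m z = Moebius_function 0 a (\<phi> z)" for z
  have m: "m z = (\<phi> z - a) / (1 - cnj a * \<phi> z)" for z
    by (simp add: m_def Moebius_function_def)
  have mhol: "m holomorphic_on ball 0 1"
    unfolding m using nz by (auto intro!: holomorphic_intros hol)
  have m0: "m 0 = 0" by (simp add: m a_def)
  have m1: "cmod (m z) < 1" if "cmod z < 1" for z
    unfolding m_def using a lt[of z] that by (intro Moebius_function_norm_lt_1) auto
  obtain h where h: "h holomorphic_on ball 0 1" "\<And>z. cmod z < 1 \<Longrightarrow> m z = z * h z"
    "deriv m 0 = h 0"
    using Schwarz3[OF mhol m0] by blast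
  \<comment> \<open>At 0 this is the derivative bound of the Schwarz lemma; elsewhere it is the
    growth bound divided by |z|.\<close>
  have "cmod (h z) \<le> 1" if z: "z \<in> ball 0 1" for z
  proof (cases "z = 0")
    case True
    then show ?thesis using Schwarz_Lemma(2)[OF mhol m0 m1, of 0] h(3) by simp
  next
    case False
    with z have "cmod z * cmod (h z) \<le> cmod z * 1"
      using Schwarz_Lemma(1)[OF mhol m0 m1, of z] h(2)[of z] by (simp add: norm_mult)
    then show ?thesis using False by simp
  qed
  moreover have "\<phi> z - \<phi> 0 = z * h z * (1 - cnj (\<phi> 0) * \<phi> z)" if "z \<in> ball 0 1" for z
    using h(2)[of z] m[of z] nz[OF that] that by (simp add: a_def divide_simps split: if_splits)
  ultimately show thesis using that h(1) by blast
qed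

text \<open>The parameters are the values at 0 of the successive Schur transforms: \<open>c\<close>
  = \<open>p 0\<close>, \<open>x\<close> = \<open>s 0\<close>, \<open>r\<close> =
  \<open>u 0\<close>. The first step is plain division by z because \<open>w 0\<close> = 0.\<close>

lemma schwarz_coeffs:
  assumes hol: "w holomorphic_on ball 0 1" and maps: "w ` ball 0 1 \<subseteq> ball 0 1" and w0: "w 0 = 0"
    and W: "w has_fps_expansion W"
  obtains c x r where "cmod c \<le> 1" "cmod x \<le> 1" "cmod r \<le> 1"
    "fps_nth W 1 = c" "fps_nth W 2 = (1 - cnj c * c) * x"
    "fps_nth W 3 = (1 - cnj c * c) * ((1 - cnj x * x) * r - cnj c * x\<^sup>2)"
proof -
  have wle: "cmod (w z) \<le> 1" if "z \<in> ball 0 1" for z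
    using maps that by (force simp: image_subset_iff)
  obtain p where p: "p holomorphic_on ball 0 1" "\<And>z. z \<in> ball 0 1 \<Longrightarrow> cmod (p z) \<le> 1"
      "\<And>z. z \<in> ball 0 1 \<Longrightarrow> w z = z * p z"
    using schur_step[OF hol wle] by (auto simp: w0)
  obtain s where s: "s holomorphic_on ball 0 1" "\<And>z. z \<in> ball 0 1 \<Longrightarrow> cmod (s z) \<le> 1"
      "\<And>z. z \<in> ball 0 1 \<Longrightarrow> p z - p 0 = z * s z * (1 - cnj (p 0) * p z)"
    using schur_step[OF p(1,2)] by blast
  obtain u where u: "u holomorphic_on ball 0 1" "\<And>z. z \<in> ball 0 1 \<Longrightarrow> cmod (u z) \<le> 1"
      "\<And>z. z \<in> ball 0 1 \<Longrightarrow> s z - s 0 = z * u z * (1 - cnj (s 0) * s z)"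
    using schur_step[OF s(1,2)] by blast
  define P S U where "P = fps_expansion p 0" and "S = fps_expansion s 0" and "U = fps_expansion u 0"
  have PSU: "p has_fps_expansion P" "s has_fps_expansion S" "u has_fps_expansion U"
    unfolding P_def S_def U_def using p s u by (auto intro: has_fps_expansion_ball)
  have eW: "W = fps_X * P"
    by (rule has_fps_expansion_unique_on_ball[OF W _ p(3)]) (intro fps_expansion_intros PSU)
  have eP: "P - fps_const (p 0) = fps_X * S * (1 - fps_const (cnj (p 0)) * P)"
  proof (rule has_fps_expansion_unique_on_ball)
    show "(\<lambda>z. p z - p 0) has_fps_expansion P - fps_const (p 0)"
      by (intro has_fps_expansion_diff has_fps_expansion_const PSU)
    show "(\<lambda>z. z * s z * (1 - cnj (p 0) * p z)) has_fps_expansion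
        fps_X * S * (1 - fps_const (cnj (p 0)) * P)"
      by (intro has_fps_expansion_mult has_fps_expansion_diff has_fps_expansion_1 has_fps_expansion_const
          has_fps_expansion_fps_X PSU)
  qed (rule s(3))
  have eS: "S - fps_const (s 0) = fps_X * U * (1 - fps_const (cnj (s 0)) * S)"
  proof (rule has_fps_expansion_unique_on_ball)
    show "(\<lambda>z. s z - s 0) has_fps_expansion S - fps_const (s 0)"
      by (intro has_fps_expansion_diff has_fps_expansion_const PSU)
    show "(\<lambda>z. z * u z * (1 - cnj (s 0) * s z)) has_fps_expansion
        fps_X * U * (1 - fps_const (cnj (s 0)) * S)"
      by (intro has_fps_expansion_mult has_fps_expansion_diff has_fps_expansion_1 has_fps_expansion_const
          has_fps_expansion_fps_X PSU)
  qed (rule u(3))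
  \<comment> \<open>With the factor \<open>fps_X\<close> in front, coefficient n on the right
    involves only coefficients of \<open>P\<close> and \<open>S\<close> below n, so this is a
    recursion.\<close>
  have nP: "fps_nth P n = fps_nth (fps_const (p 0) + fps_X * (S * (1 - fps_const (cnj (p 0)) * P))) n" for n
    using arg_cong[OF eP, of "\<lambda>F. fps_nth F n"]
    by (metis (no_types, lifting) add.commute diff_eq_eq fps_add_nth fps_sub_nth mult.assoc)
  have nS: "fps_nth S n = fps_nth (fps_const (s 0) + fps_X * (U * (1 - fps_const (cnj (s 0)) * S))) n" for n
    using arg_cong[OF eS, of "\<lambda>F. fps_nth F n"]
    by (metis (no_types, lifting) add.commute diff_eq_eq fps_add_nth fps_sub_nth mult.assoc)
  have P0: "fps_nth P 0 = p 0" using nP[of 0] by simp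
  have S0: "fps_nth S 0 = s 0" using nS[of 0] by simp
  have S1: "fps_nth S 1 = (1 - cnj (s 0) * s 0) * fps_nth U 0"
    using nS[of 1] S0 by simp
  have P1: "fps_nth P 1 = (1 - cnj (p 0) * p 0) * s 0"
    using nP[of 1] S0 P0 by simp
  have P2: "fps_nth P 2 = (1 - cnj (p 0) * p 0) * ((1 - cnj (s 0) * s 0) * fps_nth U 0 - cnj (p 0) * (s 0)\<^sup>2)"
  proof -
    have "fps_nth P 2 = fps_nth S 1 * (1 - cnj (p 0) * fps_nth P 0) - fps_nth S 0 * cnj (p 0) * fps_nth P 1"
      using nP[of 2] by (simp add: fps_mult_nth numeral_2_eq_2 algebra_simps)
    also have "\<dots> = (1 - cnj (p 0) * p 0) * ((1 - cnj (s 0) * s 0) * fps_nth U 0 - cnj (p 0) * (s 0)\<^sup>2)"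
      by (simp only: S0 P0 P1 S1) (simp add: algebra_simps power2_eq_square)
    finally show ?thesis .
  qed
  have "fps_nth U 0 = u 0"
    using has_fps_expansion_imp_0_eq_fps_nth_0[OF PSU(3)] by simp
  then show thesis
    using that[of "p 0" "s 0" "u 0"] p(2)[of 0] s(2)[of 0] u(2)[of 0] P0 P1 P2
    by (simp add: eW numeral_2_eq_2 numeral_3_eq_3)
qed

text \<open>The constant 3 is attained at \<open>c\<close> = 0 and |x| = 1, which includes the
  parameters of w = z^2.\<close>

lemma schwarz_coeffs_functional_bound:
  fixes c x r :: complex
  assumes c: "cmod c \<le> 1" and x: "cmod x \<le> 1" and r: "cmod r \<le> 1"
  defines "t \<equiv> 1 - cnj c * c"
  defines "c2 \<equiv> t * x" and "c3 \<equiv> t * ((1 - cnj x * x) * r - cnj c * x\<^sup>2)"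
  shows "cmod (4 * c * c3 + c\<^sup>2 * c2 - 3 * c2\<^sup>2 - 3/4 * c ^ 4) \<le> 3"
proof -
  define C X where "C = cmod c" and "X = cmod x"
  have CX: "0 \<le> C" "C \<le> 1" "0 \<le> X" "X \<le> 1"
    using c x by (auto simp: C_def X_def)
  have t: "t = of_real (1 - C\<^sup>2)" "1 - cnj x * x = of_real (1 - X\<^sup>2)"
    by (simp_all add: t_def C_def X_def complex_norm_square mult.commute del: of_real_power)
  have pos: "0 \<le> 1 - C\<^sup>2" "0 \<le> 1 - X\<^sup>2"
    using CX by (simp_all add: power_le_one)
  have ct: "cnj c * c = of_real (C\<^sup>2)"
    by (simp add: C_def complex_norm_square mult.commute del: of_real_power)
  \<comment> \<open>\<open>A1\<close> carries the free parameter \<open>r\<close>. \<open>A2\<close>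
    merges the two terms in x^2, one from \<open>c3\<close> and one from the square of
    \<open>c2\<close>, by 4 C^2 + 3 (1 - C^2) = 3 + C^2.\<close>
  define A1 A2 A3 A4 where
    "A1 = of_real (4 * (1 - C\<^sup>2) * (1 - X\<^sup>2)) * c * r" and
    "A2 = of_real ((1 - C\<^sup>2) * (3 + C\<^sup>2)) * x\<^sup>2" and
    "A3 = of_real (1 - C\<^sup>2) * c\<^sup>2 * x" and "A4 = 3/4 * c ^ 4"
  have "4 * c * c3 + c\<^sup>2 * c2 - 3 * c2\<^sup>2 - 3/4 * c ^ 4
      = 4 * t * (1 - cnj x * x) * c * r - (4 * t * (cnj c * c) + 3 * t\<^sup>2) * x\<^sup>2 + t * c\<^sup>2 * x - 3/4 * c ^ 4"
    by (simp add: c2_def c3_def algebra_simps power2_eq_square)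
  also have "\<dots> = A1 - A2 + A3 - A4"
    unfolding t ct A1_def A2_def A3_def A4_def by (simp add: algebra_simps power2_eq_square)
  also have "cmod \<dots> \<le> cmod A1 + cmod A2 + cmod A3 + cmod A4"
    by (smt (verit) norm_triangle_ineq norm_triangle_ineq4)
  also have "cmod A1 \<le> 4 * (1 - C\<^sup>2) * (1 - X\<^sup>2) * C"
    using pos r CX mult_left_mono[of "cmod r" 1 "4 * (1 - C\<^sup>2) * (1 - X\<^sup>2) * C"]
    by (simp add: A1_def norm_mult abs_mult C_def del: of_real_mult of_real_diff of_real_power)
  also have "cmod A2 = (1 - C\<^sup>2) * (3 + C\<^sup>2) * X\<^sup>2"
    using pos by (simp add: A2_def norm_mult norm_power abs_mult X_def del: of_real_mult of_real_diff of_real_power of_real_add)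
  also have "cmod A3 = (1 - C\<^sup>2) * C\<^sup>2 * X"
    using pos by (simp add: A3_def norm_mult norm_power C_def X_def del: of_real_mult of_real_diff of_real_power)
  also have "cmod A4 = 3/4 * C ^ 4"
    by (simp add: A4_def norm_mult norm_power C_def norm_divide)
  \<comment> \<open>Collecting powers of \<open>X\<close> leaves 3 + C^2 - 4 C = (1 - C) (3 - C) in
    front of X^2. This is nonnegative, so the sum increases with \<open>X\<close> and
    \<open>X\<close> may be replaced by 1.\<close>
  also have "4 * (1 - C\<^sup>2) * (1 - X\<^sup>2) * C + (1 - C\<^sup>2) * (3 + C\<^sup>2) * X\<^sup>2 + (1 - C\<^sup>2) * C\<^sup>2 * X + 3/4 * C ^ 4
     = (1 - C\<^sup>2) * (4 * C + (1 - C) * (3 - C) * X\<^sup>2 + C\<^sup>2 * X) + 3/4 * C ^ 4"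
    by (simp add: algebra_simps power2_eq_square)
  also have "\<dots> \<le> (1 - C\<^sup>2) * (4 * C + (1 - C) * (3 - C) * 1 + C\<^sup>2 * 1) + 3/4 * C ^ 4"
    using CX pos by (intro add_mono mult_left_mono) (auto simp: power_le_one)
  also have "\<dots> = 3 - C\<^sup>2 - 5/4 * C ^ 4"
    by (simp add: algebra_simps power2_eq_square power4_eq_xxxx)
  also have "\<dots> \<le> 3" using CX zero_le_power[of C 4] zero_le_power[of C 2] by linarith
  finally show ?thesis by simp
qed

section \<open>Univalence of starlike functions\<close>

text \<open>The curve is the local inverse of \<open>f\<close> along the segment from
  \<open>f z\<close> towards 0. Its velocity at \<open>z\<close> is -u with u = f/f', and the
  derivative of |k|^2 there is -2 Re (z f'/f) |u|^2 < 0.\<close>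

lemma starlike_inward_curve:
  assumes hol: "f holomorphic_on S" and S: "open S" "z \<in> S"
    and pos: "Re (z * deriv f z / f z) > 0"
  obtains k :: "real \<Rightarrow> complex" where "(k \<longlongrightarrow> z) (at_right 0)"
    "eventually (\<lambda>h. f (k h) = (1 - of_real h) * f z \<and> cmod (k h) < cmod z) (at_right 0)"
proof -
  define v where "v = f z"
  \<comment> \<open>Division by zero yields 0, so positivity of the quotient already excludes
    \<open>f z\<close> = 0.\<close>
  have v: "v \<noteq> 0" and d: "deriv f z \<noteq> 0"
    using pos by (auto simp: v_def)
  obtain r where r: "r > 0" "ball z r \<subseteq> S" "open (f ` ball z r)" "inj_on f (ball z r)"
    using has_complex_derivative_locally_invertible[OF hol S(2,1) d] by blast
  have holr: "f holomorphic_on ball z r"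
    using hol r(2) by (rule holomorphic_on_subset)
  obtain g where g: "g holomorphic_on (f ` ball z r)"
      "\<And>y. y \<in> ball z r \<Longrightarrow> deriv f y * deriv g (f y) = 1" "\<And>y. y \<in> ball z r \<Longrightarrow> g (f y) = y"
    using holomorphic_has_inverse[OF holr open_ball r(4)] by blast
  define k where "k h = g ((1 - of_real h) * v)" for h :: real
  have k0: "k 0 = z"
    using g(3)[of z] r(1) by (simp add: k_def v_def)
  define u where "u = v / deriv f z"
  have u: "deriv g v = inverse (deriv f z)"
    using g(2)[of z] r(1) d by (simp add: v_def field_simps)
  have "(g has_field_derivative deriv g v) (at v)"
    using g(1) r by (intro holomorphic_derivI) (auto simp: v_def)
  moreover have "((\<lambda>h::real. (1 - of_real h) * v) has_vector_derivative - v) (at 0)"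
    by (auto intro!: derivative_eq_intros)
  ultimately have dk: "(k has_vector_derivative - u) (at 0)"
    using field_vector_diff_chain_at[of "\<lambda>h::real. (1 - of_real h) * v" "- v" 0 g "deriv g v"]
    by (simp add: k_def[abs_def] o_def u u_def divide_inverse)
  have kz: "(k \<longlongrightarrow> z) (at_right 0)"
    using has_vector_derivative_continuous[OF dk] unfolding continuous_at_imp_continuous_at_within continuous_at k0
    by (rule filterlim_mono) (auto simp: at_le)
  have "((\<lambda>h. k h \<bullet> k h) has_real_derivative 2 * (z \<bullet> (- u))) (at 0)"
    unfolding has_real_derivative_iff_has_vector_derivative
    using dk by (auto intro!: derivative_eq_intros simp: k0 inner_commute has_vector_derivative_def)
  moreover have "z \<bullet> u > 0"
  proof -
    have "u \<noteq> 0" using v d by (simp add: u_def)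
    have "z \<bullet> u = Re (z * cnj u)"
      by (simp add: inner_complex_def)
    also have "z * cnj u = (z * deriv f z / f z) * (u * cnj u)"
      using v d by (simp add: u_def v_def field_simps)
    also have "Re \<dots> = Re (z * deriv f z / f z) * (cmod u)\<^sup>2"
      by (simp only: complex_norm_square[symmetric] Re_complex_of_real times_complex.sel(1) Im_complex_of_real)
    finally show ?thesis using pos \<open>u \<noteq> 0\<close> by simp
  qed
  ultimately obtain e where e: "e > 0" "\<And>h. 0 < h \<Longrightarrow> h < e \<Longrightarrow> k h \<bullet> k h < z \<bullet> z"
    using DERIV_neg_dec_right[of "\<lambda>h. k h \<bullet> k h" "2 * (z \<bullet> (- u))" 0] k0 by auto
  have "eventually (\<lambda>h. cmod (k h) < cmod z) (at_right 0)"
    unfolding eventually_at_right_field using e by (intro exI[of _ e]) (auto simp: norm_lt)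
  moreover have "eventually (\<lambda>h::real. (1 - of_real h) * v \<in> f ` ball z r) (at_right 0)"
  proof (rule topological_tendstoD[OF _ r(3)])
    show "((\<lambda>h::real. (1 - of_real h) * v) \<longlongrightarrow> v) (at_right 0)"
      by (auto intro!: tendsto_eq_intros)
    show "v \<in> f ` ball z r" using r(1) by (auto simp: v_def)
  qed
  then have "eventually (\<lambda>h. f (k h) = (1 - of_real h) * v) (at_right 0)"
    by eventually_elim (auto simp: k_def g(3))
  ultimately have "eventually (\<lambda>h. f (k h) = (1 - of_real h) * f z \<and> cmod (k h) < cmod z) (at_right 0)"
    unfolding v_def by eventually_elim auto
  with kz show thesis by (rule that)
qed

text \<open>
  If \<open>f\<close> identified two points, choose such a pair \<open>(a, b)\<close> with \<open>\<bar>a\<bar> + \<bar>b\<bar>\<close> minimal. Starlikeness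
  allows both points to be moved towards 0 along the preimages of one radial segment, which
  gives a smaller pair.
\<close>

lemma starlike_imp_inj_on:
  assumes hol: "f holomorphic_on ball 0 1" and f0: "f 0 = 0" and d0: "deriv f 0 \<noteq> 0"
    and pos: "\<And>z. z \<in> ball 0 1 - {0} \<Longrightarrow> Re (z * deriv f z / f z) > 0"
  shows "inj_on f (ball 0 1)"
proof (rule inj_onI, rule ccontr)
  fix x y assume xy: "x \<in> ball 0 1" "y \<in> ball 0 1" "f x = f y" "x \<noteq> y"
  \<comment> \<open>The minimal pair is sought in a closed disc inside the unit disc, for
    compactness.\<close>
  define r where "r = max (cmod x) (cmod y)"
  have r: "r < 1" "x \<in> cball 0 r" "y \<in> cball 0 r" using xy by (auto simp: r_def)
  have d: "deriv f a \<noteq> 0" if "a \<in> ball 0 1" for a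
    using pos[of a] d0 that by (cases "a = 0") auto
  have "\<exists>e. e > 0 \<and> inj_on f (ball a e)" if "a \<in> ball 0 1" for a
    using has_complex_derivative_locally_injective[OF hol that open_ball d[OF that]] by blast
  then obtain R where R: "\<And>a. a \<in> ball 0 1 \<Longrightarrow> R a > 0 \<and> inj_on f (ball a (R a))"
    by metis
  define E where "E = {p \<in> cball 0 r \<times> cball 0 r. f (fst p) - f (snd p) = 0}"
  \<comment> \<open>Removing only the diagonal from \<open>E\<close> need not leave a closed set.
    Local injectivity provides an open neighbourhood \<open>U\<close> of the diagonal whose removal
    deletes no pair of distinct points from \<open>E\<close>, so \<open>E - U\<close> is
    compact.\<close>
  define U where "U = (\<Union>a\<in>ball 0 1. ball a (R a) \<times> ball a (R a))"
  have cont: "continuous_on (cball 0 r) f"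
    using hol r by (intro holomorphic_on_imp_continuous_on holomorphic_on_subset[OF hol]) auto
  have "continuous_on (cball 0 r \<times> cball 0 r) (\<lambda>p. f (fst p) - f (snd p))"
    by (intro continuous_intros continuous_on_compose2[OF cont]) auto
  then have "closed E"
    unfolding E_def by (rule continuous_closed_preimage_constant) (intro closed_Times closed_cball)
  moreover have "E \<subseteq> cball 0 r \<times> cball 0 r" by (auto simp: E_def)
  ultimately have "compact E"
    by (metis compact_Int_closed compact_Times compact_cball inf.absorb_iff2)
  moreover have "open U"
    unfolding U_def by (intro open_UN ballI open_Times open_ball)
  ultimately have comp: "compact (E - U)"
    by (rule compact_diff)
  have EU: "E - U = {p \<in> cball 0 r \<times> cball 0 r. f (fst p) = f (snd p) \<and> fst p \<noteq> snd p}"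
  proof -
    have "p \<in> U" if "p \<in> cball 0 r \<times> cball 0 r" "fst p = snd p" for p
      unfolding U_def using that r(1) R[of "fst p"] by (intro UN_I[of "fst p"]) (auto simp: mem_Times_iff)
    moreover have "fst p = snd p" if "p \<in> U" "f (fst p) = f (snd p)" for p
      using that R by (auto simp: U_def inj_on_def)
    ultimately show ?thesis by (auto simp: E_def)
  qed
  have "(x, y) \<in> E - U" using xy r by (simp add: EU)
  then have ne: "E - U \<noteq> {}" by blast
  have "continuous_on (E - U) (\<lambda>p. cmod (fst p) + cmod (snd p))"
    by (intro continuous_intros)
  then obtain p where p: "p \<in> E - U"
      and min: "\<And>q. q \<in> E - U \<Longrightarrow> cmod (fst p) + cmod (snd p) \<le> cmod (fst q) + cmod (snd q)"
    using continuous_attains_inf[OF comp ne] by blast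
  obtain a b where ab: "p = (a, b)" by (cases p)
  have a: "cmod a \<le> r" "cmod b \<le> r" "f a = f b" "a \<noteq> b"
    using p by (auto simp: ab EU)
  \<comment> \<open>At another zero the quotient would be 0 by division by zero, against
    \<open>pos\<close>. Hence neither point of the minimal pair is 0, and both can be moved
    inward.\<close>
  have zero: "c = 0" if "f c = 0" "c \<in> ball 0 1" for c
    using pos[of c] that by (cases "c = 0") auto
  have "a \<noteq> 0" "b \<noteq> 0"
    using zero[of a] zero[of b] a r(1) f0 by auto
  then have ab01: "a \<in> ball 0 1 - {0}" "b \<in> ball 0 1 - {0}"
    using a r(1) by auto
  obtain k where k: "(k \<longlongrightarrow> a) (at_right 0)"
      "eventually (\<lambda>h. f (k h) = (1 - of_real h) * f a \<and> cmod (k h) < cmod a) (at_right 0)"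
    using starlike_inward_curve[OF hol open_ball _ pos[OF ab01(1)]] ab01 by blast
  obtain l where l: "(l \<longlongrightarrow> b) (at_right 0)"
      "eventually (\<lambda>h. f (l h) = (1 - of_real h) * f b \<and> cmod (l h) < cmod b) (at_right 0)"
    using starlike_inward_curve[OF hol open_ball _ pos[OF ab01(2)]] ab01 by blast
  \<comment> \<open>Both curves scale the common value by the same factor 1 - h; the distinct limits
    keep the moved points apart for small h.\<close>
  have "((\<lambda>h. k h - l h) \<longlongrightarrow> a - b) (at_right 0)"
    by (intro tendsto_diff k l)
  then have "eventually (\<lambda>h. k h - l h \<noteq> 0) (at_right 0)"
    by (rule tendsto_imp_eventually_ne) (use a in simp)
  with k(2) l(2) have "eventually (\<lambda>h. k h \<noteq> l h \<and> f (k h) = f (l h) \<and> cmod (k h) < cmod a \<and> cmod (l h) < cmod b) (at_right 0)"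
    by eventually_elim (use a in auto)
  then obtain h where h: "k h \<noteq> l h" "f (k h) = f (l h)" "cmod (k h) < cmod a" "cmod (l h) < cmod b"
    using eventually_happens'[OF trivial_limit_at_right_real] by blast
  then have "(k h, l h) \<in> E - U"
    using a by (simp add: EU)
  from min[OF this] h show False by (simp add: ab)
qed

section \<open>The square root and the lune function on the disc\<close>

lemma Re_one_plus_pos: "cmod u < 1 \<Longrightarrow> Re (1 + u) > 0"
  using abs_Re_le_cmod[of u] by auto

text \<open>Keeps the argument of \<open>csqrt\<close> off the branch cut; applied with exponents 2
  and 4.\<close>

lemma one_plus_power_not_nonpos:
  assumes "cmod u < 1" "n > 0"
  shows "1 + u ^ n \<notin> \<real>\<^sub>\<le>\<^sub>0"
proof -
  have "cmod (u ^ n) < 1"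
    using assms by (simp add: norm_power power_less_one_iff)
  then show ?thesis
    using Re_one_plus_pos[of "u ^ n"] by (auto simp: complex_nonpos_Reals_iff)
qed

lemma Re_csqrt_pos:
  assumes "u \<notin> \<real>\<^sub>\<le>\<^sub>0"
  shows "Re (csqrt u) > 0"
proof (rule ccontr)
  assume "\<not> ?thesis"
  then have "Re (csqrt u) = 0"
    using Re_csqrt[of u] by linarith
  then have "Re ((csqrt u)\<^sup>2) \<le> 0" "Im ((csqrt u)\<^sup>2) = 0"
    by (simp_all only: Re_power2 Im_power2) simp_all
  then have "u \<in> \<real>\<^sub>\<le>\<^sub>0"
    by (simp add: complex_nonpos_Reals_iff)
  with assms show False by contradiction
qed

lemma lune_fun_holomorphic: "lune_fun holomorphic_on ball 0 1"
  unfolding lune_fun_def[abs_def]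
  by (intro holomorphic_intros one_plus_power_not_nonpos) auto

text \<open>With s the root, (s + u) (s - u) = 1. Inversion preserves the sign of the real part, so
  Re (s + u) <= 0 would force Re (s - u) <= 0, and adding would contradict Re s > 0.\<close>

lemma Re_lune_fun_pos:
  assumes "cmod u < 1"
  shows "Re (lune_fun u) > 0"
proof (rule ccontr)
  define s where "s = csqrt (1 + u\<^sup>2)"
  have s: "Re s > 0"
    unfolding s_def by (intro Re_csqrt_pos one_plus_power_not_nonpos assms) simp
  assume "\<not> ?thesis"
  then have le: "Re (s + u) \<le> 0" by (simp add: lune_fun_def s_def add.commute)
  have "(s + u) * (s - u) = 1"
    by (simp add: s_def algebra_simps flip: power2_eq_square)
  then have "s - u = inverse (s + u)"
    by (metis inverse_unique)
  moreover have "Re (inverse (s + u)) \<le> 0"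
    using le by (simp add: divide_nonpos_nonneg)
  ultimately have "Re (s - u) \<le> 0" by simp
  with le s show False by simp
qed

section \<open>Logarithmic coefficients and the upper bound\<close>

lemma deriv_exp_form:
  assumes L: "L holomorphic_on ball 0 1" and f: "\<And>z. z \<in> ball 0 1 \<Longrightarrow> f z = z * exp (L z)"
    and z: "z \<in> ball 0 1"
  shows "deriv f z = exp (L z) * (1 + z * deriv L z)"
proof -
  have "(L has_field_derivative deriv L z) (at z)"
    using L z by (intro holomorphic_derivI) auto
  then have "((\<lambda>z. z * exp (L z)) has_field_derivative exp (L z) * (1 + z * deriv L z)) (at z)"
    by (auto intro!: derivative_eq_intros simp: algebra_simps)
  then have "(f has_field_derivative exp (L z) * (1 + z * deriv L z)) (at z)"
    by (rule has_field_derivative_transform_within_open[OF _ open_ball z]) (use f in auto)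
  then show ?thesis by (rule DERIV_imp_deriv)
qed

text \<open>Logarithmic differentiation away from 0; at 0 the formula agrees with the value 1 filled
  in by \<open>starlike_quotient\<close>.\<close>

lemma starlike_quotient_exp_form:
  assumes "L holomorphic_on ball 0 1" "\<And>z. z \<in> ball 0 1 \<Longrightarrow> f z = z * exp (L z)" "z \<in> ball 0 1"
  shows "starlike_quotient f z = 1 + z * deriv L z"
  using deriv_exp_form[OF assms] assms(2)[OF assms(3)]
  by (simp add: starlike_quotient_def)

text \<open>Stated for any Schwarz function realising the subordination, so that it serves both the
  general bound and the evaluation at \<open>extremal_g\<close>.\<close>

lemma hankel21_log_eq:
  assumes f: "f \<in> class_S"
    and w: "w holomorphic_on ball 0 1" "w ` ball 0 1 \<subseteq> ball 0 1" "w 0 = 0"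
    and eq: "\<And>z. z \<in> ball 0 1 \<Longrightarrow> starlike_quotient f z = lune_fun (w z)"
    and W: "w has_fps_expansion W"
  defines "c1 \<equiv> fps_nth W 1" and "c2 \<equiv> fps_nth W 2" and "c3 \<equiv> fps_nth W 3"
  shows "hankel21_log f = (4 * c1 * c3 + c1\<^sup>2 * c2 - 3 * c2\<^sup>2 - 3/4 * c1 ^ 4) / 48"
proof -
  define L where "L = log_quotient f"
  have L: "L holomorphic_on ball 0 1" "\<And>z. z \<in> ball 0 1 - {0} \<Longrightarrow> exp (L z) = f z / z"
    using is_log_quotient_log_quotient[OF f] by (auto simp: L_def is_log_quotient_def)
  have fL: "f z = z * exp (L z)" if "z \<in> ball 0 1" for z
    using L(2)[of z] f that by (cases "z = 0") (auto simp: class_S_def)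
  have key: "z * deriv L z = w z + csqrt (1 + (w z)\<^sup>2) - 1" if "z \<in> ball 0 1" for z
    using starlike_quotient_exp_form[OF L(1) fL that] eq[OF that]
    by (simp add: lune_fun_def algebra_simps)
  define Q where "Q z = csqrt (1 + (w z)\<^sup>2)" for z
  have "Q holomorphic_on ball 0 1"
    unfolding Q_def[abs_def] using w(2)
    by (intro holomorphic_intros one_plus_power_not_nonpos w(1)) (auto simp: image_subset_iff)
  then have S: "Q has_fps_expansion fps_expansion Q 0" (is "_ has_fps_expansion ?S")
    by (rule has_fps_expansion_ball)
  have LF: "L has_fps_expansion fps_expansion L 0" (is "_ has_fps_expansion ?L")
    using L(1) by (rule has_fps_expansion_ball)
  have eL: "fps_X * fps_deriv ?L = W + ?S - 1"
    by (rule has_fps_expansion_unique_on_ball[of "\<lambda>z. z * deriv L z" _ "\<lambda>z. w z + Q z - 1"])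
       ((intro fps_expansion_intros LF S W)+, simp add: key Q_def)
  \<comment> \<open>The series of the root is determined by its square together with the constant
    term 1, which selects the branch.\<close>
  have eS: "?S * ?S = 1 + W * W"
    by (rule has_fps_expansion_unique_on_ball[of "\<lambda>z. Q z * Q z" _ "\<lambda>z. 1 + w z * w z"])
       ((intro fps_expansion_intros S W)+, simp add: Q_def flip: power2_eq_square)
  have W0: "fps_nth W 0 = 0"
    using has_fps_expansion_imp_0_eq_fps_nth_0[OF W] w(3) by simp
  have S0: "fps_nth ?S 0 = 1"
    using has_fps_expansion_imp_0_eq_fps_nth_0[OF S] w(3) by (simp add: Q_def)
  have nS: "fps_nth (?S * ?S) n = fps_nth (1 + W * W) n" for n
    by (simp only: eS)
  have S1: "fps_nth ?S 1 = 0"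
    using nS[of 1] S0 W0 by (simp add: fps_mult_nth)
  have S2: "fps_nth ?S 2 = c1\<^sup>2 / 2"
    using nS[of 2] S0 S1 W0 by (simp add: fps_mult_nth numeral_2_eq_2 c1_def power2_eq_square mult.commute[of _ 2])
  have S3: "fps_nth ?S 3 = c1 * c2"
    using nS[of 3] S0 S1 W0 by (simp add: fps_mult_nth numeral_2_eq_2 numeral_3_eq_3 c1_def c2_def)
  have nL: "fps_nth (fps_X * fps_deriv ?L) n = fps_nth (W + ?S - 1) n" for n
    by (simp only: eL)
  have g1: "fps_nth ?L 1 = c1"
    using nL[of 1] S1 by (simp add: c1_def)
  have g2: "fps_nth ?L 2 = (c2 + c1\<^sup>2 / 2) / 2"
  proof -
    have "fps_nth ?L 2 = (fps_nth W 2 + fps_nth ?S 2) / 2"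
      using nL[of 2] by (simp add: numeral_2_eq_2 mult.commute[of _ 2])
    then show ?thesis by (simp only: S2 c2_def)
  qed
  have g3: "fps_nth ?L 3 = (c3 + c1 * c2) / 3"
  proof -
    have "fps_nth ?L 3 = (fps_nth W 3 + fps_nth ?S 3) / 3"
      using nL[of 3] by (simp add: numeral_3_eq_3 mult.commute[of _ 3])
    then show ?thesis by (simp only: S3 c3_def)
  qed
  show ?thesis
    unfolding hankel21_log_def log_coeff_def L_def[symmetric] g1 g2 g3
    by (simp add: field_simps power2_eq_square power4_eq_xxxx)
qed

lemma hankel21_log_le:
  assumes "f \<in> S_lune"
  shows "cmod (hankel21_log f) \<le> 1 / 16"
proof -
  obtain w where f: "f \<in> class_S" and w: "w holomorphic_on ball 0 1" "w ` ball 0 1 \<subseteq> ball 0 1" "w 0 = 0"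
      and eq: "\<And>z. z \<in> ball 0 1 \<Longrightarrow> starlike_quotient f z = lune_fun (w z)"
    using assms by (auto simp: S_lune_def subordinate_def)
  note W = has_fps_expansion_ball[OF w(1)]
  obtain c x r where c: "cmod c \<le> 1" "cmod x \<le> 1" "cmod r \<le> 1"
    and coeffs: "fps_nth (fps_expansion w 0) 1 = c" "fps_nth (fps_expansion w 0) 2 = (1 - cnj c * c) * x"
    "fps_nth (fps_expansion w 0) 3 = (1 - cnj c * c) * ((1 - cnj x * x) * r - cnj c * x\<^sup>2)"
    by (rule schwarz_coeffs[OF w W])
  have eq48: "hankel21_log f = (4 * fps_nth (fps_expansion w 0) 1 * fps_nth (fps_expansion w 0) 3
      + (fps_nth (fps_expansion w 0) 1)\<^sup>2 * fps_nth (fps_expansion w 0) 2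
      - 3 * (fps_nth (fps_expansion w 0) 2)\<^sup>2 - 3/4 * fps_nth (fps_expansion w 0) 1 ^ 4) / 48"
    by (rule hankel21_log_eq[OF f w eq W])
  show ?thesis
    using schwarz_coeffs_functional_bound[of c x r] c unfolding eq48 coeffs norm_divide by simp
qed

section \<open>The extremal function\<close>

text \<open>Rationalising the root removes the singularity of the integrand at 0. The integrand then
  has a primitive on the disc, and \<open>L\<close> is its increment from 0.\<close>

lemma extremal_g_exp_form:
  "\<exists>L. L holomorphic_on ball 0 1 \<and> L 0 = 0 \<and>
    (\<forall>z\<in>ball 0 1. extremal_g z = z * exp (L z) \<and> 1 + z * deriv L z = lune_fun (z\<^sup>2))"
proof -
  define p :: "complex \<Rightarrow> complex" where "p = (\<lambda>x. (x\<^sup>2 + csqrt (1 + x ^ 4) - 1) / x)"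
  have nz: "csqrt (1 + x ^ 4) + 1 \<noteq> 0" for x :: complex
  proof
    assume "csqrt (1 + x ^ 4) + 1 = 0"
    then have "Re (csqrt (1 + x ^ 4)) = -1"
      by (metis add_eq_0_iff2 one_complex.sel(1) uminus_complex.sel(1))
    then show False
      using Re_csqrt[of "1 + x ^ 4"] by linarith
  qed
  \<comment> \<open>The identity includes x = 0, where division by zero gives \<open>p\<close> the
    value 0 of its holomorphic extension.\<close>
  have "p x = x + x ^ 3 / (csqrt (1 + x ^ 4) + 1)" for x
  proof (cases "x = 0")
    case False
    have "(csqrt (1 + x ^ 4) - 1) * (csqrt (1 + x ^ 4) + 1) = x ^ 4"
      by (simp add: algebra_simps flip: power2_eq_square)
    then have "csqrt (1 + x ^ 4) - 1 = x ^ 4 / (csqrt (1 + x ^ 4) + 1)"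
      using nz[of x] by (simp add: eq_divide_eq)
    then have "p x = (x\<^sup>2 + x ^ 4 / (csqrt (1 + x ^ 4) + 1)) / x"
      by (simp add: p_def add_diff_eq[symmetric])
    also have "\<dots> = x + x ^ 3 / (csqrt (1 + x ^ 4) + 1)"
      using False by (simp add: add_divide_distrib power2_eq_square power3_eq_cube power4_eq_xxxx)
    finally show ?thesis .
  qed (simp add: p_def)
  then have p: "p = (\<lambda>x. x + x ^ 3 / (csqrt (1 + x ^ 4) + 1))"
    by blast
  have "p holomorphic_on ball 0 1"
    unfolding p by (intro holomorphic_intros one_plus_power_not_nonpos nz) auto
  then obtain G where G: "\<And>x. x \<in> ball 0 1 \<Longrightarrow> (G has_field_derivative p x) (at x within ball 0 1)"
    using holomorphic_convex_primitive'[OF convex_ball open_ball] by blast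
  define L where "L z = G z - G 0" for z
  have dL: "(L has_field_derivative p z) (at z)" if "z \<in> ball 0 1" for z
    using G[OF that] that unfolding L_def[abs_def]
    by (auto intro!: derivative_eq_intros simp: at_within_open[OF that open_ball])
  have "extremal_g z = z * exp (L z)" if "z \<in> ball 0 1" for z
  proof -
    have "closed_segment 0 z \<subseteq> ball 0 1"
      using that by (intro closed_segment_subset) auto
    then have "(p has_contour_integral (G (pathfinish (linepath 0 z)) - G (pathstart (linepath 0 z)))) (linepath 0 z)"
      by (intro contour_integral_primitive[OF G]) auto
    then show ?thesis
      by (simp add: extremal_g_def L_def p_def contour_integral_unique)
  qed
  moreover have "1 + z * deriv L z = lune_fun (z\<^sup>2)" if "z \<in> ball 0 1" for z
    using DERIV_imp_deriv[OF dL[OF that]] by (simp add: p_def lune_fun_def flip: power_mult)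
  moreover have "L holomorphic_on ball 0 1"
    unfolding holomorphic_on_open[OF open_ball] using dL by blast
  moreover have "L 0 = 0"
    by (simp add: L_def)
  ultimately show ?thesis by blast
qed

lemma square_schwarz_function:
  "(\<lambda>z::complex. z\<^sup>2) holomorphic_on ball 0 1" "(\<lambda>z::complex. z\<^sup>2) ` ball 0 1 \<subseteq> ball 0 1"
  by (intro holomorphic_intros) (auto simp: norm_power power_less_one_iff)

lemma starlike_quotient_extremal_g:
  assumes "z \<in> ball 0 1"
  shows "starlike_quotient extremal_g z = lune_fun (z\<^sup>2)"
proof -
  obtain L where L: "L holomorphic_on ball 0 1" "L 0 = 0" "\<And>z. z \<in> ball 0 1 \<Longrightarrow> extremal_g z = z * exp (L z)"
    "\<And>z. z \<in> ball 0 1 \<Longrightarrow> 1 + z * deriv L z = lune_fun (z\<^sup>2)"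
    using extremal_g_exp_form by metis
  show ?thesis
    using starlike_quotient_exp_form[OF L(1,3) assms] L(4)[OF assms] by simp
qed

lemma extremal_g_nonzero:
  assumes "z \<in> ball 0 1 - {0}"
  shows "extremal_g z \<noteq> 0"
proof -
  obtain L where L: "L holomorphic_on ball 0 1" "L 0 = 0"
    "\<And>z. z \<in> ball 0 1 \<Longrightarrow> extremal_g z = z * exp (L z)"
    "\<And>z. z \<in> ball 0 1 \<Longrightarrow> 1 + z * deriv L z = lune_fun (z\<^sup>2)"
    using extremal_g_exp_form by metis
  show ?thesis using assms L(3)[of z] by simp
qed

lemma extremal_g_in_class_S: "extremal_g \<in> class_S"
proof -
  obtain L where L: "L holomorphic_on ball 0 1" "L 0 = 0"
    "\<And>z. z \<in> ball 0 1 \<Longrightarrow> extremal_g z = z * exp (L z)"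
    "\<And>z. z \<in> ball 0 1 \<Longrightarrow> 1 + z * deriv L z = lune_fun (z\<^sup>2)"
    using extremal_g_exp_form by metis
  have "(\<lambda>z. z * exp (L z)) holomorphic_on ball 0 1"
    by (intro holomorphic_intros L)
  then have hol: "extremal_g holomorphic_on ball 0 1"
    by (rule holomorphic_transform) (simp add: L(3))
  have g0: "extremal_g 0 = 0"
    by (simp add: extremal_g_def)
  have d0: "deriv extremal_g 0 = 1"
  proof -
    have "deriv extremal_g 0 = exp (L 0) * (1 + 0 * deriv L 0)"
      by (rule deriv_exp_form[OF L(1,3)]) simp_all
    then show ?thesis by (simp add: L(2))
  qed
  have "inj_on extremal_g (ball 0 1)"
  proof (rule starlike_imp_inj_on[OF hol g0])
    fix z :: complex assume z: "z \<in> ball 0 1 - {0}"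
    then have "z * deriv extremal_g z / extremal_g z = lune_fun (z\<^sup>2)"
      using starlike_quotient_extremal_g[of z] by (simp add: starlike_quotient_def)
    then show "Re (z * deriv extremal_g z / extremal_g z) > 0"
      using Re_lune_fun_pos[of "z\<^sup>2"] z by (simp add: norm_power power_less_one_iff)
  qed (simp add: d0)
  then show ?thesis
    using hol g0 d0 by (simp add: class_S_def)
qed

lemma extremal_g_in_S_lune: "extremal_g \<in> S_lune"
proof -
  have "(\<lambda>z. lune_fun (z\<^sup>2)) holomorphic_on ball 0 1"
    using holomorphic_on_compose_gen[OF square_schwarz_function(1) lune_fun_holomorphic
        square_schwarz_function(2)] by (simp add: o_def)
  then have "starlike_quotient extremal_g holomorphic_on ball 0 1"
    by (rule holomorphic_transform) (simp add: starlike_quotient_extremal_g)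
  moreover have "\<exists>w. w holomorphic_on ball 0 1 \<and> w ` ball 0 1 \<subseteq> ball 0 1 \<and> w 0 = 0 \<and>
      (\<forall>z\<in>ball 0 1. starlike_quotient extremal_g z = lune_fun (w z))"
    using square_schwarz_function by (intro exI[of _ "\<lambda>z. z\<^sup>2"]) (simp add: starlike_quotient_extremal_g)
  ultimately show ?thesis
    using extremal_g_in_class_S lune_fun_holomorphic by (simp add: S_lune_def subordinate_def)
qed

text \<open>The coefficients come from the differential equation z g' = (z^2 + sqrt(1 + z^4)) g. As
  the root has constant term 1, order n reads (n - 1) g_n = terms in lower coefficients.\<close>

lemma extremal_g_coeffs:
  "map (fps_nth (fps_expansion extremal_g 0)) [0..<6] = [0, 1, 0, 1/2, 0, 1/4]"
proof -
  define Q :: "complex \<Rightarrow> complex" where "Q = (\<lambda>z. csqrt (1 + z ^ 4))"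
  have "Q holomorphic_on ball 0 1"
    unfolding Q_def by (intro holomorphic_intros one_plus_power_not_nonpos) auto
  then have S: "Q has_fps_expansion fps_expansion Q 0" (is "_ has_fps_expansion ?S")
    by (rule has_fps_expansion_ball)
  have g: "extremal_g 0 = 0" "deriv extremal_g 0 = 1" "extremal_g holomorphic_on ball 0 1"
    using extremal_g_in_class_S by (auto simp: class_S_def)
  then have G: "extremal_g has_fps_expansion fps_expansion extremal_g 0" (is "_ has_fps_expansion ?G")
    by (intro has_fps_expansion_ball)
  have key: "z * deriv extremal_g z = (z\<^sup>2 + Q z) * extremal_g z" if "z \<in> ball 0 1" for z
  proof (cases "z = 0")
    case False
    then show ?thesis
      using starlike_quotient_extremal_g[OF that] extremal_g_nonzero[of z] that
      by (simp add: starlike_quotient_def lune_fun_def Q_def divide_eq_eq flip: power_mult)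
  qed (simp add: g)
  have eS: "?S * ?S = 1 + fps_X ^ 4"
    by (rule has_fps_expansion_unique_on_ball[of "\<lambda>z. Q z * Q z" _ "\<lambda>z. 1 + z ^ 4"])
       ((intro fps_expansion_intros S)+, simp add: Q_def flip: power2_eq_square)
  have eG: "fps_X * fps_deriv ?G = (fps_X\<^sup>2 + ?S) * ?G"
    by (rule has_fps_expansion_unique_on_ball[of "\<lambda>z. z * deriv extremal_g z" _
          "\<lambda>z. (z\<^sup>2 + Q z) * extremal_g z"])
       ((intro fps_expansion_intros S G)+, rule key)
  have nS: "fps_nth (?S * ?S) n = fps_nth (1 + fps_X ^ 4) n" for n
    by (simp only: eS)
  have nG: "fps_nth (fps_X * fps_deriv ?G) n = fps_nth (fps_X * (fps_X * ?G) + ?S * ?G) n" for n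
    by (simp only: eG distrib_right power2_eq_square mult.assoc)
  note nat_simps = eval_nat_numeral
  have S0: "fps_nth ?S 0 = 1"
    using has_fps_expansion_imp_0_eq_fps_nth_0[OF S] by (simp add: Q_def)
  have S1: "fps_nth ?S (Suc 0) = 0"
    using nS[of 1] S0 by (simp add: fps_mult_nth)
  have S2: "fps_nth ?S (Suc (Suc 0)) = 0"
    using nS[of 2] S0 S1 by (simp add: fps_mult_nth nat_simps)
  have S3: "fps_nth ?S (Suc (Suc (Suc 0))) = 0"
    using nS[of 3] S0 S1 S2 by (simp add: fps_mult_nth nat_simps)
  have S4: "fps_nth ?S (Suc (Suc (Suc (Suc 0)))) = 1/2"
    using nS[of 4] S0 S1 S2 S3 by (simp add: fps_mult_nth nat_simps mult.commute[of _ 2])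
  have G0: "fps_nth ?G 0 = 0"
    using has_fps_expansion_imp_0_eq_fps_nth_0[OF G] g by simp
  \<comment> \<open>At order 1 the recursion is vacuous, so the normalisation of the derivative
    supplies this coefficient.\<close>
  have G1: "fps_nth ?G (Suc 0) = 1"
    using fps_nth_fps_expansion[OF G, of 1] g by simp
  have G2: "fps_nth ?G (Suc (Suc 0)) = 0"
    using nG[of 2] G0 G1 S0 S1 by (simp add: fps_mult_nth[of ?S] nat_simps mult.commute[of _ 2] mult.commute[of _ 4])
  have G3: "fps_nth ?G (Suc (Suc (Suc 0))) = 1/2"
    using nG[of 3] G0 G1 G2 S0 S1 S2 by (simp add: fps_mult_nth[of ?S] nat_simps mult.commute[of _ 2] mult.commute[of _ 4])
  have G4: "fps_nth ?G (Suc (Suc (Suc (Suc 0)))) = 0"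
    using nG[of 4] G0 G1 G2 G3 S0 S1 S2 S3 by (simp add: fps_mult_nth[of ?S] nat_simps mult.commute[of _ 2] mult.commute[of _ 4])
  have G5: "fps_nth ?G (Suc (Suc (Suc (Suc (Suc 0))))) = 1/4"
    using nG[of 5] G0 G1 G2 G3 G4 S0 S1 S2 S3 S4 by (simp add: fps_mult_nth[of ?S] nat_simps mult.commute[of _ 2] mult.commute[of _ 4])
  show ?thesis
    by (simp add: upt_rec G0 G1 G2 G3 G4 G5 nat_simps)
qed

lemma hankel21_log_extremal_g: "cmod (hankel21_log extremal_g) = 1 / 16"
proof -
  \<comment> \<open>For w = z^2 the coefficients are c1 = c3 = 0 and c2 = 1, so only the term -3
    c2^2 survives.\<close>
  have "hankel21_log extremal_g = - 3 / 48"
    using hankel21_log_eq[OF extremal_g_in_class_S square_schwarz_function _ starlike_quotient_extremal_g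
        has_fps_expansion_fps_X_power[of 2]]
    by (simp add: fps_X_power_nth)
  then show ?thesis by (simp add: norm_divide)
qed

theorem theorem3p1:
  shows "(\<forall>f\<in>S_lune. cmod (hankel21_log f) \<le> 1 / 16) \<and>
    extremal_g \<in> S_lune \<and>
    map (fps_nth (fps_expansion extremal_g 0)) [0..<6] = [0, 1, 0, 1/2, 0, 1/4] \<and>
    cmod (hankel21_log extremal_g) = 1 / 16"
  using hankel21_log_le extremal_g_in_S_lune extremal_g_coeffs hankel21_log_extremal_g by blast

end
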